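(* Let $G$ be a locally compact Hausdorff group, let $\alpha$ be a partial action of $G$ on a $C^*$-algebra $A$, and assume that $(\beta,B)$ and $(\gamma,C)$ are enveloping actions of $(\alpha,A)$. Then there exists a unique isomorphism of $C^*$-algebras $\phi:B\to C$ such that $\phi\beta_t=\gamma_t\phi$ for all $t\in G$ and $\phi|_A=\mathrm{id}_A$.
   Context: Ideals of $C^*$-algebras are closed and two-sided. A partial action of $G$ on a $C^*$-algebra $A$ is a pair $\alpha=(\{D_t\}_{t\in G},\{\alpha_t\}_{t\in G})$ where each $D_t$ is an ideal of $A$, each $\alpha_t:D_{t^{-1}}\to D_t$ is a $*$-isomorphism, $D_e=A$, $\alpha_{st}$ extends $\alpha_s\alpha_t$ for all $s,t\in G$, the family $\{D_t\}$ is continuous (for every open $U\subseteq A$ the set $\{t\in G: U\cap D_t\neq\emptyset\}$ is open in $G$), and the map $(t,a)\mapsto\alpha_t(a)$ is continuous on $\{(t,a)\in G\times A: a\in D_{t^{-1}}\}$. Let $\beta$ be a continuous (global) action of $G$ on a $C^*$-algebra $B$ containing $A$. The pair $(\beta,B)$ is an enveloping action of $(\alpha,A)$ if: (1) $A$ is an ideal of $B$; (2) $\alpha=\beta|_A$, that is, $D_t=A\cap\beta_t(A)$ and $\alpha_t(x)=\beta_t(x)$ for all $t\in G$, $x\in D_{t^{-1}}$; (3) $B$ is the closed linear span of $\{\beta_t(x): t\in G, x\in A\}$. *)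

theory Defs
  imports "HOL-Analysis.Analysis"
begin

text \<open>A $C^*$-algebra, not necessarily unital. The real scalar multiplication inherited from
  \<^class>\<open>real_normed_algebra\<close> is the restriction of the complex one; completeness comes from
  \<^class>\<open>banach\<close>.\<close>

class cstar_algebra = real_normed_algebra + banach +
  fixes scaleC :: "complex \<Rightarrow> 'a \<Rightarrow> 'a" (infixr "*\<^sub>C" 75)
    and star :: "'a \<Rightarrow> 'a"
  assumes scaleC_add_right: "c *\<^sub>C (x + y) = c *\<^sub>C x + c *\<^sub>C y"
    and scaleC_add_left: "(c + d) *\<^sub>C x = c *\<^sub>C x + d *\<^sub>C x"
    and scaleC_scaleC: "c *\<^sub>C d *\<^sub>C x = (c * d) *\<^sub>C x"
    and scaleC_one: "1 *\<^sub>C x = x"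
    and scaleR_scaleC: "r *\<^sub>R x = complex_of_real r *\<^sub>C x"
    and norm_scaleC: "norm (c *\<^sub>C x) = cmod c * norm x"
    and mult_scaleC_left: "(c *\<^sub>C x) * y = c *\<^sub>C (x * y)"
    and mult_scaleC_right: "x * (c *\<^sub>C y) = c *\<^sub>C (x * y)"
    and star_add: "star (x + y) = star x + star y"
    and star_scaleC: "star (c *\<^sub>C x) = cnj c *\<^sub>C star x"
    and star_mult: "star (x * y) = star y * star x"
    and star_star: "star (star x) = x"
    and cstar_identity: "norm (star x * x) = norm x ^ 2"

global_interpretation complex_vector:
  vector_space "scaleC :: complex \<Rightarrow> 'a \<Rightarrow> 'a :: cstar_algebra"
  by unfold_locales (auto simp: scaleC_add_right scaleC_add_left scaleC_scaleC scaleC_one)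

definition closed_ideal :: "'a::cstar_algebra set \<Rightarrow> bool" where
  "closed_ideal I \<longleftrightarrow>
     complex_vector.subspace I \<and> closed I \<and> (\<forall>x\<in>I. \<forall>a. a * x \<in> I \<and> x * a \<in> I)"

text \<open>Used when \<open>S\<close> is a closed ideal; such an \<open>S\<close> is automatically closed under \<^const>\<open>star\<close>.
  The values of \<open>f\<close> outside \<open>S\<close> are irrelevant.\<close>

definition star_hom_on :: "'a::cstar_algebra set \<Rightarrow> ('a \<Rightarrow> 'b::cstar_algebra) \<Rightarrow> bool" where
  "star_hom_on S f \<longleftrightarrow>
     (\<forall>x\<in>S. \<forall>y\<in>S. f (x + y) = f x + f y \<and> f (x * y) = f x * f y) \<and>
     (\<forall>x\<in>S. (\<forall>c. f (c *\<^sub>C x) = c *\<^sub>C f x) \<and> f (star x) = star (f x))"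

definition star_iso_on ::
    "'a::cstar_algebra set \<Rightarrow> 'b::cstar_algebra set \<Rightarrow> ('a \<Rightarrow> 'b) \<Rightarrow> bool" where
  "star_iso_on S T f \<longleftrightarrow> star_hom_on S f \<and> bij_betw f S T"

text \<open>The group is written additively, since the topological groups of the library are;
  \<^class>\<open>group_add\<close> does not assume commutativity. So $st$, $t^{-1}$, $e$ become
  \<open>s + t\<close>, \<open>- t\<close>, \<open>0\<close>.
  The fourth conjunct says that \<open>\<alpha> (s + t)\<close> extends \<open>\<alpha> s \<circ> \<alpha> t\<close>, where the domain of this
  composition consists of those \<open>x\<close> in the domain of \<open>\<alpha> t\<close> whose image lies in the domain
  of \<open>\<alpha> s\<close>.\<close>

definition partial_action ::
    "('g::topological_group_add \<Rightarrow> 'a::cstar_algebra set) \<Rightarrow> ('g \<Rightarrow> 'a \<Rightarrow> 'a) \<Rightarrow> bool" where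
  "partial_action D \<alpha> \<longleftrightarrow>
     (\<forall>t. closed_ideal (D t)) \<and>
     (\<forall>t. star_iso_on (D (- t)) (D t) (\<alpha> t)) \<and>
     D 0 = UNIV \<and>
     (\<forall>s t. \<forall>x \<in> D (- t). \<alpha> t x \<in> D (- s) \<longrightarrow>
        x \<in> D (- (s + t)) \<and> \<alpha> (s + t) x = \<alpha> s (\<alpha> t x)) \<and>
     (\<forall>U. open U \<longrightarrow> open {t. U \<inter> D t \<noteq> {}}) \<and>
     continuous_on {(t, a). a \<in> D (- t)} (\<lambda>(t, a). \<alpha> t a)"

text \<open>Continuity is joint continuity of $(t, b) \mapsto \beta_t(b)$, as for partial actions; since
  $*$-automorphisms are isometric, this is equivalent to strong continuity.\<close>

definition global_action ::
    "('g::topological_group_add \<Rightarrow> 'b::cstar_algebra \<Rightarrow> 'b) \<Rightarrow> bool" where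
  "global_action \<beta> \<longleftrightarrow> partial_action (\<lambda>_. UNIV) \<beta>"

text \<open>As \<open>A\<close> and \<open>B\<close> are types, the inclusion of \<open>A\<close> in \<open>B\<close> as a $C^*$-subalgebra is an
  isometric $*$-homomorphism \<open>\<iota>\<close>.\<close>

definition enveloping_action ::
    "('g::topological_group_add \<Rightarrow> 'a::cstar_algebra set) \<Rightarrow> ('g \<Rightarrow> 'a \<Rightarrow> 'a) \<Rightarrow>
     ('g \<Rightarrow> 'b::cstar_algebra \<Rightarrow> 'b) \<Rightarrow> ('a \<Rightarrow> 'b) \<Rightarrow> bool" where
  "enveloping_action D \<alpha> \<beta> \<iota> \<longleftrightarrow>
     global_action \<beta> \<and>
     star_hom_on UNIV \<iota> \<and> (\<forall>x. norm (\<iota> x) = norm x) \<and>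
     closed_ideal (range \<iota>) \<and>
     (\<forall>t. \<iota> ` D t = range \<iota> \<inter> \<beta> t ` range \<iota>) \<and>
     (\<forall>t. \<forall>x \<in> D (- t). \<iota> (\<alpha> t x) = \<beta> t (\<iota> x)) \<and>
     closure (complex_vector.span {\<beta> t (\<iota> x) |t x. True}) = UNIV"

end

theory Submission
  imports Defs
begin

text \<open>The isomorphism must send \<open>\<Sum> \<beta>\<^sub>t (\<iota> x)\<close> to \<open>\<Sum> \<gamma>\<^sub>t (\<kappa> x)\<close>, so the point is that these finite sums have
  the same norm. The products \<open>\<beta>\<^sub>s (\<iota> x) * \<iota> a\<close> are images of elements of the ideal \<open>D s\<close>, and these
  elements are determined by the partial action, because an element of \<open>D s\<close> is determined by
  its products with \<open>D s\<close>. Hence corresponding sums act by left multiplication in the same way on each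
  translate of the ideal. For \<open>h = b\<^sup>* b\<close> with \<open>b\<close> such a sum, the norms of these multiplications
  bound the growth of the powers of \<open>h\<close>, hence \<open>\<parallel>h\<parallel>\<close> since \<open>\<parallel>h\<parallel>\<^sup>n = \<parallel>h\<^sup>n\<parallel>\<close> for \<open>n = 2\<^sup>k\<close>.
  No spectral theory is needed. Uniqueness holds without automatic continuity: two such
  isomorphisms agree after multiplication by any translate of the ideal.\<close>

section \<open>Elementary facts on C*-algebras and *-homomorphisms\<close>

lemma star_hom_on_UNIV:
  assumes "star_hom_on UNIV f"
  shows "f (x + y) = f x + f y" "f (x * y) = f x * f y" "f (c *\<^sub>C x) = c *\<^sub>C f x"
    "f (star x) = star (f x)"
  using assms by (auto simp: star_hom_on_def)

lemma star_hom_on_UNIV_linear: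
  assumes "star_hom_on UNIV f"
  shows "linear f"
  by (rule linearI) (simp_all add: star_hom_on_UNIV[OF assms] scaleR_scaleC)

lemma norm_star [simp]: "norm (star (x::'a::cstar_algebra)) = norm x"
proof -
  have le: "norm y \<le> norm (star y)" for y :: 'a
  proof (cases "y = 0")
    case False
    have "norm y * norm y \<le> norm (star y) * norm y"
      using norm_mult_ineq[of "star y" y] by (simp add: cstar_identity power2_eq_square)
    with False show ?thesis by simp
  qed simp
  show ?thesis using le[of x] le[of "star x"] by (simp add: star_star)
qed

lemma star_mult_self_eq_0: "star x * x = 0 \<longleftrightarrow> x = (0::'a::cstar_algebra)"
  by (metis cstar_identity mult_zero_right norm_eq_zero power_eq_0_iff zero_neq_numeral)

lemma star_diff: "star (x - y) = star x - star (y::'a::cstar_algebra)"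
  by (simp add: eq_diff_eq flip: star_add)

lemma tendsto_star:
  fixes f :: "_ \<Rightarrow> 'a::cstar_algebra"
  assumes "(f \<longlongrightarrow> l) F"
  shows "((\<lambda>x. star (f x)) \<longlongrightarrow> star l) F"
  using assms by (simp add: tendsto_iff dist_norm flip: star_diff)

lemma tendsto_scaleC:
  fixes f :: "_ \<Rightarrow> 'a::cstar_algebra"
  assumes "(f \<longlongrightarrow> l) F"
  shows "((\<lambda>x. c *\<^sub>C f x) \<longlongrightarrow> c *\<^sub>C l) F"
proof -
  have "bounded_linear ((*\<^sub>C) c :: 'a \<Rightarrow> 'a)"
    by (rule bounded_linear_intro[where K = "cmod c"])
      (simp_all add: scaleC_add_right scaleR_scaleC scaleC_scaleC norm_scaleC mult.commute)
  then show ?thesis using assms by (rule bounded_linear.tendsto)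
qed

section \<open>Norms of powers of self-adjoint elements\<close>

text \<open>There is no unit, so the power \<open>h\<^sup>m\<^sup>+\<^sup>1\<close> is expressed as \<open>((*) h ^^ m) h\<close>.\<close>

lemma funpow_mult_left_mult:
  "((*) h ^^ m) x * y = ((*) h ^^ m) (x * (y::'a::semigroup_mult))"
  by (induction m) (simp_all add: mult.assoc)

lemma star_funpow_mult_left:
  assumes "star h = (h::'a::cstar_algebra)"
  shows "star (((*) h ^^ m) h) = ((*) h ^^ m) h"
proof (induction m)
  case (Suc m)
  have "star (((*) h ^^ Suc m) h) = ((*) h ^^ m) h * h"
    by (simp add: star_mult Suc assms)
  also have "\<dots> = ((*) h ^^ Suc m) h"
    by (simp add: funpow_mult_left_mult funpow_swap1)
  finally show ?case .
qed (simp add: assms)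

text \<open>Repeated squaring: powers \<open>L\<close> of \<open>h\<close> are again self-adjoint,
  so the C*-identity gives \<open>norm (L * L) = (norm L)\<^sup>2\<close>.\<close>

lemma norm_funpow_mult_left:
  assumes "star h = (h::'a::cstar_algebra)"
  shows "norm (((*) h ^^ (2 ^ k - 1)) h) = norm h ^ 2 ^ k"
proof (induction k)
  case (Suc k)
  let ?L = "((*) h ^^ (2 ^ k - 1)) h"
  \<comment> \<open>In \<open>L * L\<close>, the first \<open>L\<close> supplies
    \<open>2 ^ k - 1\<close> multiplications by \<open>h\<close> applied to \<open>h * L\<close>,
    and \<open>h * L\<close> is \<open>2 ^ k\<close> multiplications applied to
    \<open>h\<close>.\<close>
  have e: "2 ^ Suc k - 1 = (2 ^ k - 1) + Suc (2 ^ k - 1 :: nat)"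
    by (simp add: mult_2)
  have "((*) h ^^ (2 ^ Suc k - 1)) h = star ?L * ?L"
    unfolding e star_funpow_mult_left[OF assms]
    by (simp only: funpow_add funpow_mult_left_mult funpow.simps(2) o_apply)
  then have "norm (((*) h ^^ (2 ^ Suc k - 1)) h) = (norm ?L)\<^sup>2"
    by (simp only: cstar_identity)
  also have "\<dots> = norm h ^ 2 ^ Suc k"
    unfolding Suc by (simp add: mult.commute flip: power_mult)
  finally show ?case .
qed simp

text \<open>If \<open>0 < P < a\<close>, the numbers \<open>(a / P) ^ 2 ^ k\<close> are unbounded
  and exceed every constant \<open>M / P\<close>.\<close>

lemma le_if_power_two_power_le:
  fixes a P M :: real
  assumes "0 \<le> a" "0 \<le> P" and le: "\<And>k. a ^ 2 ^ k \<le> M * P ^ (2 ^ k - 1)"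
  shows "a \<le> P"
proof (rule ccontr)
  assume "\<not> a \<le> P"
  then have "P < a" by simp
  show False
  proof (cases "P = 0")
    case True
    \<comment> \<open>The instance \<open>k = 1\<close> makes the right side vanish; for
      \<open>k = 0\<close> it would be \<open>M * P ^ 0 = M\<close>.\<close>
    then show ?thesis using le[of 1] \<open>P < a\<close> by simp
  next
    case False
    then have P: "P > 0" using assms by simp
    then obtain n where n: "M / P < (a / P) ^ n"
      using real_arch_pow[of "a / P" "M / P"] \<open>P < a\<close> by auto
    also have "\<dots> \<le> (a / P) ^ 2 ^ n"
      using P \<open>P < a\<close> less_exp[of n] by (intro power_increasing) (auto simp: less_imp_le)
    finally have "M * P ^ 2 ^ n < a ^ 2 ^ n * P"
      using P by (simp add: power_divide field_simps)
    moreover have "P ^ 2 ^ n = P ^ (2 ^ n - 1) * P"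
      by (metis power_minus_mult zero_less_numeral zero_less_power)
    ultimately show False using le[of n] P by (simp add: mult.assoc[symmetric])
  qed
qed

text \<open>Comparing \<open>f (h ^ 2 ^ k)\<close> with \<open>h ^ 2 ^ k\<close> for \<open>h = x\<^sup>* x\<close> removes the constant of boundedness.\<close>

lemma continuous_star_hom_contractive:
  fixes f :: "'a::cstar_algebra \<Rightarrow> 'b::cstar_algebra"
  assumes f: "star_hom_on UNIV f" and cont: "continuous_on UNIV f"
  shows "norm (f x) \<le> norm x"
proof -
  note hom = star_hom_on_UNIV[OF f]
  note linear = star_hom_on_UNIV_linear[OF f]
  obtain d where d: "d > 0" "\<And>x. norm x < d \<Longrightarrow> norm (f x) < 1"
    using cont[unfolded continuous_on_iff, rule_format, of 0 1]
    by (auto simp: linear_0[OF linear])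
  \<comment> \<open>Rescaling \<open>x\<close> to norm \<open>d / 2\<close> turns continuity at
    \<open>0\<close> into a linear bound.\<close>
  have M: "norm (f x) \<le> norm x * (2 / d)" for x
  proof (cases "x = 0")
    case False
    have "norm (f ((d / (2 * norm x)) *\<^sub>R x)) < 1"
      using d(1) False by (intro d(2)) simp
    then show ?thesis
      using d(1) False by (simp add: linear_scale[OF linear] field_simps)
  qed (simp add: linear_0[OF linear])
  define h where "h = star x * x"
  have h: "star h = h" "star (f h) = f h"
    by (simp_all add: h_def star_mult star_star flip: hom)
  have pow: "f (((*) h ^^ m) h) = ((*) (f h) ^^ m) (f h)" for m
    by (induction m) (simp_all add: hom)
  have "norm (f h) \<le> norm h"
  proof (rule le_if_power_two_power_le)
    fix k
    have "norm (f h) ^ 2 ^ k \<le> norm h ^ 2 ^ k * (2 / d)"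
      using M[of "((*) h ^^ (2 ^ k - 1)) h"] by (simp add: pow norm_funpow_mult_left h del: One_nat_def)
    also have "norm h ^ 2 ^ k = norm h ^ (2 ^ k - 1) * norm h"
      by (metis power_minus_mult zero_less_numeral zero_less_power)
    finally show "norm (f h) ^ 2 ^ k \<le> (2 / d * norm h) * norm h ^ (2 ^ k - 1)"
      by (simp add: mult_ac)
  qed simp_all
  then have "(norm (f x))\<^sup>2 \<le> (norm x)\<^sup>2"
    by (simp add: h_def hom cstar_identity)
  then show ?thesis by (rule power2_le_imp_le) simp
qed

section \<open>Global actions by isometric automorphisms\<close>

lemma global_action_facts:
  assumes "global_action \<beta>"
  shows "star_hom_on UNIV (\<beta> t)" "\<beta> (s + t) x = \<beta> s (\<beta> t x)" "\<beta> 0 x = x"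
    "\<beta> (- t) (\<beta> t x) = x" "\<beta> t (\<beta> (- t) x) = x" "norm (\<beta> t x) = norm x"
proof -
  have iso: "star_iso_on UNIV UNIV (\<beta> t)" for t
    using assms by (simp add: global_action_def partial_action_def)
  then show hom: "star_hom_on UNIV (\<beta> t)" for t by (simp add: star_iso_on_def)
  show add: "\<beta> (s + t) x = \<beta> s (\<beta> t x)" for s t x
    using assms by (simp add: global_action_def partial_action_def)
  \<comment> \<open>\<open>\<beta> 0\<close> is injective and idempotent, hence the
    identity.\<close>
  have "inj (\<beta> 0)" using iso[of 0] by (simp add: star_iso_on_def bij_betw_def)
  moreover have "\<beta> 0 (\<beta> 0 x) = \<beta> 0 x" for x using add[of 0 0 x] by simp
  ultimately show zero: "\<beta> 0 x = x" for x by (auto dest: injD)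
  show inv1: "\<beta> (- t) (\<beta> t x) = x" for t x using add[of "- t" t x] zero by simp
  show "\<beta> t (\<beta> (- t) x) = x" using inv1[of "- t"] by simp
  have joint: "continuous_on UNIV (\<lambda>(t, a). \<beta> t a)"
    using assms by (simp add: global_action_def partial_action_def)
  have "continuous_on UNIV (\<beta> t)" for t
    using continuous_on_compose2[OF joint, of UNIV "Pair t"]
    by (simp add: continuous_on_Pair continuous_on_const continuous_on_id)
  then have le: "norm (\<beta> t x) \<le> norm x" for t x
    using hom continuous_star_hom_contractive by blast
  \<comment> \<open>Both \<open>\<beta> t\<close> and its inverse \<open>\<beta> (- t)\<close> are
    contractive.\<close>
  show "norm (\<beta> t x) = norm x"
    using le[of t x] le[of "- t" "\<beta> t x"] by (simp add: inv1)
qed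

section \<open>The ideal and its translates in one enveloping algebra\<close>

locale enveloping =
  fixes D :: "'g::topological_group_add \<Rightarrow> 'a::cstar_algebra set"
    and \<alpha> :: "'g \<Rightarrow> 'a \<Rightarrow> 'a"
    and \<beta> :: "'g \<Rightarrow> 'b::cstar_algebra \<Rightarrow> 'b"
    and \<iota> :: "'a \<Rightarrow> 'b"
  assumes partial: "partial_action D \<alpha>"
    and env: "enveloping_action D \<alpha> \<beta> \<iota>"
begin

lemma global: "global_action \<beta>"
  using env by (simp add: enveloping_action_def)

lemmas act = global_action_facts[OF global]
lemmas act_hom = star_hom_on_UNIV[OF act(1)]

lemma incl_star_hom: "star_hom_on UNIV \<iota>"
  using env by (simp add: enveloping_action_def)

lemmas incl_hom = star_hom_on_UNIV[OF incl_star_hom]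

lemma norm_incl [simp]: "norm (\<iota> x) = norm x"
  using env by (simp add: enveloping_action_def)

lemma linear_incl: "linear \<iota>" and linear_act: "linear (\<beta> t)"
  by (simp_all add: star_hom_on_UNIV_linear incl_star_hom act(1))

lemma incl_eq_iff [simp]: "\<iota> x = \<iota> y \<longleftrightarrow> x = y"
  using norm_incl[of "x - y"] by (auto simp: linear_diff[OF linear_incl])

lemma incl_partial: "x \<in> D (- t) \<Longrightarrow> \<iota> (\<alpha> t x) = \<beta> t (\<iota> x)"
  using env by (simp add: enveloping_action_def)

lemma domain_ideal:
  assumes "x \<in> D t"
  shows "a * x \<in> D t" "x * a \<in> D t"
  using partial assms by (auto simp: partial_action_def closed_ideal_def)

lemma domain_diff: "x \<in> D t \<Longrightarrow> y \<in> D t \<Longrightarrow> x - y \<in> D t"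
  using partial complex_vector.subspace_diff by (auto simp: partial_action_def closed_ideal_def)

lemma partial_mem:
  assumes "x \<in> D (- t)"
  shows "\<alpha> t x \<in> D t"
proof -
  have "star_iso_on (D (- t)) (D t) (\<alpha> t)" using partial by (simp add: partial_action_def)
  then show ?thesis using assms by (auto simp: star_iso_on_def bij_betw_def)
qed

text \<open>The product lies in the ideal because its right factor does, and in the
  \<open>s\<close>-translate because its left factor does; the intersection of the two is the image
  of \<open>D s\<close>.\<close>

lemma translate_mult_incl:
  obtains w where "w \<in> D s" "\<iota> w = \<beta> s (\<iota> x) * \<iota> a"
proof -
  have ideal: "closed_ideal (range \<iota>)" and D: "\<iota> ` D s = range \<iota> \<inter> \<beta> s ` range \<iota>"
    using env by (auto simp: enveloping_action_def)
  have "\<beta> s (\<iota> x) * \<iota> a \<in> range \<iota>"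
    using ideal by (simp add: closed_ideal_def)
  moreover have "\<beta> s (\<iota> x) * \<iota> a = \<beta> s (\<iota> x * \<beta> (- s) (\<iota> a))"
    by (simp add: act_hom act)
  moreover have "\<iota> x * \<beta> (- s) (\<iota> a) \<in> range \<iota>"
    using ideal by (simp add: closed_ideal_def)
  ultimately have "\<beta> s (\<iota> x) * \<iota> a \<in> \<iota> ` D s"
    unfolding D by auto
  then show ?thesis using that by force
qed

text \<open>The right side mentions only the partial action, so the products of \<open>w\<close>
  with elements of \<open>D s\<close> are the same in every enveloping algebra. It arises by writing
  \<open>u\<close> as the \<open>s\<close>-translate of \<open>\<alpha> (- s) u\<close>.\<close>

lemma domain_mult_eq:
  assumes "u \<in> D s" "\<iota> w = \<beta> s (\<iota> x) * \<iota> a"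
  shows "u * w = \<alpha> s (\<alpha> (- s) u * x) * a"
proof -
  have "\<alpha> (- s) u \<in> D (- s)" "\<iota> (\<alpha> (- s) u) = \<beta> (- s) (\<iota> u)"
    using assms(1) partial_mem[of u "- s"] incl_partial[of u "- s"] by simp_all
  then have "\<iota> (\<alpha> s (\<alpha> (- s) u * x)) = \<iota> u * \<beta> s (\<iota> x)"
    by (simp add: incl_partial domain_ideal incl_hom act_hom act)
  then have "\<iota> (u * w) = \<iota> (\<alpha> s (\<alpha> (- s) u * x) * a)"
    by (simp add: incl_hom assms(2) mult.assoc)
  then show ?thesis by simp
qed

lemma dense: "closure (complex_vector.span {\<beta> t (\<iota> x) |t x. True}) = UNIV"
  using env by (simp add: enveloping_action_def)

text \<open>By density and continuity \<open>d\<close> annihilates everything, in particular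
  \<open>star d\<close>.\<close>

lemma eq_0_if_annihilates:
  assumes "\<And>t x. d * \<beta> t (\<iota> x) = 0"
  shows "d = 0"
proof -
  have sub: "d * y = 0" if "y \<in> complex_vector.span {\<beta> t (\<iota> x) |t x. True}" for y
    using that
    by (induction rule: complex_vector.span_induct_alt)
      (auto simp: distrib_left mult_scaleC_right assms)
  have "closed {y. d * y = 0}"
    by (intro closed_Collect_eq continuous_intros)
  then have "closure (complex_vector.span {\<beta> t (\<iota> x) |t x. True}) \<subseteq> {y. d * y = 0}"
    using sub by (intro closure_minimal) auto
  then have "d * star d = 0" unfolding dense by auto
  then have "star (star d) * star d = 0" by (simp add: star_star)
  then have "star d = 0" by (simp only: star_mult_self_eq_0)
  then show ?thesis by (metis norm_star norm_eq_zero)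
qed

end

section \<open>Corresponding products and finite sums in two enveloping algebras\<close>

locale two_enveloping =
  B: enveloping D \<alpha> \<beta> \<iota> + C: enveloping D \<alpha> \<gamma> \<kappa>
  for D :: "'g::topological_group_add \<Rightarrow> 'a::cstar_algebra set"
    and \<alpha> :: "'g \<Rightarrow> 'a \<Rightarrow> 'a"
    and \<beta> :: "'g \<Rightarrow> 'b::cstar_algebra \<Rightarrow> 'b"
    and \<gamma> :: "'g \<Rightarrow> 'c::cstar_algebra \<Rightarrow> 'c"
    and \<iota> :: "'a \<Rightarrow> 'b"
    and \<kappa> :: "'a \<Rightarrow> 'c"
begin

text \<open>Each algebra yields its own candidate in \<open>D s\<close>; by
  \<open>domain_mult_eq\<close> their difference \<open>v\<close> is killed by left multiplication
  by \<open>D s\<close>.\<close>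

lemma incl_product_matched:
  obtains w where "\<iota> w = \<beta> s (\<iota> x) * \<iota> a" "\<kappa> w = \<gamma> s (\<kappa> x) * \<kappa> a"
proof -
  obtain w where w: "w \<in> D s" "\<iota> w = \<beta> s (\<iota> x) * \<iota> a"
    by (rule B.translate_mult_incl)
  obtain w' where w': "w' \<in> D s" "\<kappa> w' = \<gamma> s (\<kappa> x) * \<kappa> a"
    by (rule C.translate_mult_incl)
  define v where "v = w - w'"
  \<comment> \<open>This element serves as the multiplier \<open>u\<close>: it lies in
    \<open>D s\<close> by the ideal property, and \<open>v * star v * v = 0\<close> makes the square
    of \<open>star v * v\<close> vanish.\<close>
  have "v * star v \<in> D s"
    unfolding v_def by (intro B.domain_ideal B.domain_diff w w')
  then have "v * star v * v = 0"
    unfolding v_def using B.domain_mult_eq[OF _ w(2)] C.domain_mult_eq[OF _ w'(2)]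
    by (simp add: right_diff_distrib)
  then have "star (star v * v) * (star v * v) = 0"
    by (simp add: star_mult star_star mult.assoc)
  then have "v = 0" by (simp only: star_mult_self_eq_0)
  then show ?thesis using that w w' by (simp add: v_def)
qed

text \<open>Pulling the product back by \<open>- t\<close> reduces it to a translate by
  \<open>- t + s\<close> times an element of the ideal.\<close>

lemma translate_product_matched:
  obtains w where "\<beta> s (\<iota> x) * \<beta> t (\<iota> a) = \<beta> t (\<iota> w)"
    "\<gamma> s (\<kappa> x) * \<gamma> t (\<kappa> a) = \<gamma> t (\<kappa> w)"
proof -
  obtain w where w: "\<iota> w = \<beta> (- t + s) (\<iota> x) * \<iota> a" "\<kappa> w = \<gamma> (- t + s) (\<kappa> x) * \<kappa> a"
    by (rule incl_product_matched)
  show ?thesis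
    by (rule that[of w]) (simp_all add: w B.act_hom C.act_hom B.act C.act)
qed

text \<open>A relation, because an element can be a sum of translates in several ways; that the
  partner is unique comes only from the norm comparison.\<close>

inductive matched :: "'b \<Rightarrow> 'c \<Rightarrow> bool" where
  translate: "matched (\<beta> t (\<iota> x)) (\<gamma> t (\<kappa> x))"
| add: "matched b c \<Longrightarrow> matched b' c' \<Longrightarrow> matched (b + b') (c + c')"

lemma matched_scaleC: "matched b c \<Longrightarrow> matched (z *\<^sub>C b) (z *\<^sub>C c)"
proof (induction rule: matched.induct)
  case (translate t x)
  then show ?case
    using matched.translate[of t "z *\<^sub>C x"] by (simp add: B.act_hom C.act_hom B.incl_hom C.incl_hom)
qed (simp add: scaleC_add_right matched.add)

lemma matched_star: "matched b c \<Longrightarrow> matched (star b) (star c)"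
proof (induction rule: matched.induct)
  case (translate t x)
  then show ?case
    using matched.translate[of t "star x"] by (simp add: B.act_hom C.act_hom B.incl_hom C.incl_hom)
qed (simp add: star_add matched.add)

lemma matched_act: "matched b c \<Longrightarrow> matched (\<beta> s b) (\<gamma> s c)"
proof (induction rule: matched.induct)
  case (translate t x)
  then show ?case using matched.translate[of "s + t" x] by (simp add: B.act C.act)
qed (simp add: B.act_hom C.act_hom matched.add)

text \<open>One \<open>w\<close> serves both algebras, so left multiplication by \<open>b\<close> on
  a translate can be estimated through \<open>c\<close>.\<close>

lemma matched_mult_translate:
  assumes "matched b c"
  shows "\<exists>w. b * \<beta> t (\<iota> a) = \<beta> t (\<iota> w) \<and> c * \<gamma> t (\<kappa> a) = \<gamma> t (\<kappa> w)"
  using assms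
proof (induction rule: matched.induct)
  case (translate s x)
  then show ?case by (metis translate_product_matched)
next
  case (add b c b' c')
  then obtain w w' where "b * \<beta> t (\<iota> a) = \<beta> t (\<iota> w)" "c * \<gamma> t (\<kappa> a) = \<gamma> t (\<kappa> w)"
    "b' * \<beta> t (\<iota> a) = \<beta> t (\<iota> w')" "c' * \<gamma> t (\<kappa> a) = \<gamma> t (\<kappa> w')" by blast
  then show ?case
    by (intro exI[of _ "w + w'"])
      (simp add: distrib_right B.act_hom C.act_hom B.incl_hom C.incl_hom)
qed

lemma matched_mult:
  assumes "matched b c" "matched b' c'"
  shows "matched (b * b') (c * c')"
  using assms(2)
proof (induction rule: matched.induct)
  case (translate t a)
  then show ?case using matched_mult_translate[OF assms(1)] by (metis matched.translate)
qed (simp add: distrib_left matched.add)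

lemma matched_zero: "matched 0 0"
  using matched.translate[of 0 0]
  by (simp add: B.act linear_0[OF B.linear_incl] C.act linear_0[OF C.linear_incl])

lemma matched_diff:
  assumes "matched b c" "matched b' c'"
  shows "matched (b - b') (c - c')"
proof -
  have m: "(-1) *\<^sub>C x = - x" for x :: "'d::cstar_algebra"
    using scaleR_scaleC[of "-1" x] by simp
  show ?thesis
    using matched.add[OF assms(1) matched_scaleC[OF assms(2), of "-1"]] by (simp add: m)
qed

section \<open>Norm comparison of corresponding finite sums\<close>

definition left_bounded :: "'b \<Rightarrow> real \<Rightarrow> bool" where
  "left_bounded h P \<longleftrightarrow> 0 \<le> P \<and>
    (\<forall>t x. \<exists>w. h * \<beta> t (\<iota> x) = \<beta> t (\<iota> w) \<and> norm w \<le> P * norm x)"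

text \<open>\<open>M\<close> is the sum of the norms of the summands of \<open>b\<close>. It does
  not depend on \<open>m\<close>, so it disappears when roots of high powers are taken.\<close>

lemma matched_funpow_bound:
  assumes "matched b c"
  shows "\<exists>M. \<forall>h P m. left_bounded h P \<longrightarrow> norm (((*) h ^^ m) b) \<le> M * P ^ m"
  using assms
proof (induction rule: matched.induct)
  case (translate t x)
  have "norm (((*) h ^^ m) (\<beta> t (\<iota> x))) \<le> norm x * P ^ m" if h: "left_bounded h P" for h P m
  proof -
    \<comment> \<open>The representative \<open>w\<close> is carried along so that the next
      multiplication by \<open>h\<close> again meets an element of the same translate.\<close>
    have "\<exists>w. ((*) h ^^ m) (\<beta> t (\<iota> x)) = \<beta> t (\<iota> w) \<and> norm w \<le> norm x * P ^ m"
    proof (induction m)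
      case 0
      show ?case by auto
    next
      case (Suc m)
      then obtain w where w: "((*) h ^^ m) (\<beta> t (\<iota> x)) = \<beta> t (\<iota> w)" "norm w \<le> norm x * P ^ m"
        by blast
      obtain w' where w': "h * \<beta> t (\<iota> w) = \<beta> t (\<iota> w')" "norm w' \<le> P * norm w"
        using h by (auto simp: left_bounded_def)
      have "P * norm w \<le> P * (norm x * P ^ m)"
        using w h by (intro mult_left_mono) (auto simp: left_bounded_def)
      with w' have "norm w' \<le> norm x * P ^ Suc m" by (simp add: mult_ac)
      with w w' show ?case by auto
    qed
    then show ?thesis by (auto simp: B.act)
  qed
  then show ?case by blast
next
  case (add b c b' c')
  from add.IH(1) obtain M where
    M: "\<And>h P m. left_bounded h P \<Longrightarrow> norm (((*) h ^^ m) b) \<le> M * P ^ m" by blast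
  from add.IH(2) obtain M' where
    M': "\<And>h P m. left_bounded h P \<Longrightarrow> norm (((*) h ^^ m) b') \<le> M' * P ^ m" by blast
  have sum: "((*) h ^^ m) (b + b') = ((*) h ^^ m) b + ((*) h ^^ m) b'" for h m
    by (induction m) (simp_all add: distrib_left)
  have "norm (((*) h ^^ m) (b + b')) \<le> (M + M') * P ^ m" if "left_bounded h P" for h P m
    unfolding sum distrib_right by (intro norm_triangle_le add_mono M M' that)
  then show ?case by blast
qed

text \<open>Left multiplication by \<open>h = b\<^sup>* b\<close> maps each translate of the ideal to itself with norm at
  most \<open>\<parallel>c\<parallel>\<^sup>2\<close>, as can be seen in the other algebra. Since \<open>h\<close> is a finite sum of elements of
  translates, the powers of \<open>h\<close> grow at most like those of \<open>\<parallel>c\<parallel>\<^sup>2\<close>.\<close>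

lemma matched_norm_le:
  assumes "matched b c"
  shows "norm b \<le> norm c"
proof -
  define h where "h = star b * b"
  have m: "matched h (star c * c)"
    unfolding h_def by (intro matched_mult matched_star assms)
  have "\<exists>w. h * \<beta> t (\<iota> x) = \<beta> t (\<iota> w) \<and> norm w \<le> (norm c)\<^sup>2 * norm x" for t x
  proof -
    obtain w where w: "h * \<beta> t (\<iota> x) = \<beta> t (\<iota> w)" "star c * c * \<gamma> t (\<kappa> x) = \<gamma> t (\<kappa> w)"
      using matched_mult_translate[OF m] by blast
    have "norm w = norm (star c * c * \<gamma> t (\<kappa> x))"
      by (simp add: w C.act)
    also have "\<dots> \<le> norm (star c * c) * norm (\<gamma> t (\<kappa> x))"
      by (rule norm_mult_ineq)
    also have "\<dots> = (norm c)\<^sup>2 * norm x"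
      by (simp add: cstar_identity C.act)
    finally show ?thesis using w by blast
  qed
  then have H: "left_bounded h ((norm c)\<^sup>2)" by (simp add: left_bounded_def)
  \<comment> \<open>Here \<open>h\<close> is both the multiplier and the finite sum that it acts
    on.\<close>
  then obtain M where M: "\<And>k. norm (((*) h ^^ k) h) \<le> M * ((norm c)\<^sup>2) ^ k"
    using matched_funpow_bound[OF m] by blast
  have "norm h \<le> (norm c)\<^sup>2"
  proof (rule le_if_power_two_power_le)
    show "norm h ^ 2 ^ k \<le> M * ((norm c)\<^sup>2) ^ (2 ^ k - 1)" for k
      using M[of "2 ^ k - 1"] by (simp add: norm_funpow_mult_left h_def star_mult star_star del: One_nat_def)
  qed simp_all
  then have "(norm b)\<^sup>2 \<le> (norm c)\<^sup>2" by (simp add: h_def cstar_identity)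
  then show ?thesis by (rule power2_le_imp_le) simp
qed

section \<open>Passage from finite sums to limits\<close>

definition extended :: "'b \<Rightarrow> 'c \<Rightarrow> bool" where
  "extended b c \<longleftrightarrow> (\<exists>X Y. (\<forall>n. matched (X n) (Y n)) \<and> X \<longlonglongrightarrow> b \<and> Y \<longlonglongrightarrow> c)"

end

context two_enveloping
begin

text \<open>Exchanging the two algebras gives the reverse of \<open>matched_norm_le\<close>, so the
  correspondence is isometric.\<close>

interpretation swap: two_enveloping D \<alpha> \<gamma> \<beta> \<kappa> \<iota>
  by unfold_locales

lemma matched_swap: "swap.matched c b \<longleftrightarrow> matched b c"
proof
  show "matched b c" if "swap.matched c b"
    using that by (induction rule: swap.matched.induct) (auto intro: matched.intros)
  show "swap.matched c b" if "matched b c"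
    using that by (induction rule: matched.induct) (auto intro: swap.matched.intros)
qed

lemma matched_norm_eq: "matched b c \<Longrightarrow> norm b = norm c"
  using matched_norm_le swap.matched_norm_le matched_swap by (simp add: order_antisym)

lemma extended_swap: "swap.extended c b \<longleftrightarrow> extended b c"
  unfolding extended_def swap.extended_def matched_swap by blast

lemma extended_norm_eq:
  assumes "extended b c"
  shows "norm b = norm c"
proof -
  obtain X Y where XY: "\<And>n. matched (X n) (Y n)" "X \<longlonglongrightarrow> b" "Y \<longlonglongrightarrow> c"
    using assms unfolding extended_def by blast
  have "(\<lambda>n. norm (X n)) = (\<lambda>n. norm (Y n))"
    using matched_norm_eq[OF XY(1)] by simp
  then show ?thesis
    using tendsto_norm[OF XY(2)] tendsto_norm[OF XY(3)] LIMSEQ_unique by metis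
qed

lemma extended_matched: "matched b c \<Longrightarrow> extended b c"
  unfolding extended_def by (intro exI[of _ "\<lambda>_. b"] exI[of _ "\<lambda>_. c"]) simp

text \<open>The common limit argument for all operations; unary ones enter as binary ones that
  ignore their second argument.\<close>

lemma extended_map2:
  assumes "extended b c" "extended b' c'"
    and "\<And>b c b' c'. matched b c \<Longrightarrow> matched b' c' \<Longrightarrow> matched (f b b') (g c c')"
    and "\<And>X X'. X \<longlonglongrightarrow> b \<Longrightarrow> X' \<longlonglongrightarrow> b' \<Longrightarrow> (\<lambda>n. f (X n) (X' n)) \<longlonglongrightarrow> f b b'"
    and "\<And>Y Y'. Y \<longlonglongrightarrow> c \<Longrightarrow> Y' \<longlonglongrightarrow> c' \<Longrightarrow> (\<lambda>n. g (Y n) (Y' n)) \<longlonglongrightarrow> g c c'"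
  shows "extended (f b b') (g c c')"
proof -
  obtain X Y where "\<And>n. matched (X n) (Y n)" "X \<longlonglongrightarrow> b" "Y \<longlonglongrightarrow> c"
    using assms(1) unfolding extended_def by blast
  moreover obtain X' Y' where "\<And>n. matched (X' n) (Y' n)" "X' \<longlonglongrightarrow> b'" "Y' \<longlonglongrightarrow> c'"
    using assms(2) unfolding extended_def by blast
  ultimately show ?thesis
    unfolding extended_def
    by (intro exI[of _ "\<lambda>n. f (X n) (X' n)"] exI[of _ "\<lambda>n. g (Y n) (Y' n)"] conjI allI assms(3-5))
qed

lemma extended_add: "extended b c \<Longrightarrow> extended b' c' \<Longrightarrow> extended (b + b') (c + c')"
  by (rule extended_map2) (assumption | rule matched.add tendsto_add)+

lemma extended_diff: "extended b c \<Longrightarrow> extended b' c' \<Longrightarrow> extended (b - b') (c - c')"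
  by (rule extended_map2) (assumption | rule matched_diff tendsto_diff)+

lemma extended_mult: "extended b c \<Longrightarrow> extended b' c' \<Longrightarrow> extended (b * b') (c * c')"
  by (rule extended_map2) (assumption | rule matched_mult tendsto_mult)+

lemma extended_scaleC: "extended b c \<Longrightarrow> extended (z *\<^sub>C b) (z *\<^sub>C c)"
  by (rule extended_map2[where f = "\<lambda>x y. z *\<^sub>C x" and g = "\<lambda>x y. z *\<^sub>C x"])
    (assumption | rule matched_scaleC tendsto_scaleC)+

lemma extended_star: "extended b c \<Longrightarrow> extended (star b) (star c)"
  by (rule extended_map2[where f = "\<lambda>x y. star x" and g = "\<lambda>x y. star x"])
    (assumption | rule matched_star tendsto_star)+

lemma extended_act:
  assumes "extended b c"
  shows "extended (\<beta> t b) (\<gamma> t c)"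
proof -
  have "bounded_linear (\<beta> t)" "bounded_linear (\<gamma> t)"
    using B.linear_act C.linear_act
    by (auto simp: bounded_linear_def bounded_linear_axioms_def B.act C.act
        intro!: exI[of _ 1])
  then show ?thesis
    using extended_map2[OF assms assms, of "\<lambda>x y. \<beta> t x" "\<lambda>x y. \<gamma> t x"]
    by (simp add: matched_act bounded_linear.tendsto)
qed

text \<open>The difference \<open>c - c'\<close> is paired with \<open>b - b = 0\<close> and so has
  norm \<open>0\<close>.\<close>

lemma extended_unique: "extended b c \<Longrightarrow> extended b c' \<Longrightarrow> c = c'"
  using extended_diff[of b c b c'] extended_norm_eq by fastforce

lemma extended_total: "\<exists>c. extended b c"
proof -
  have span: "\<exists>c. matched y c" if "y \<in> complex_vector.span {\<beta> t (\<iota> x) |t x. True}" for y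
    using that
  proof (induction rule: complex_vector.span_induct_alt)
    case base
    then show ?case using matched_zero by blast
  next
    case (step z x y)
    then show ?case by (blast intro: matched.add matched_scaleC matched.translate)
  qed
  have "b \<in> closure (complex_vector.span {\<beta> t (\<iota> x) |t x. True})"
    unfolding B.dense by simp
  then obtain X where X: "\<And>n. X n \<in> complex_vector.span {\<beta> t (\<iota> x) |t x. True}" "X \<longlonglongrightarrow> b"
    by (auto simp: closure_sequential)
  have "\<forall>n. \<exists>c. matched (X n) c" using span X(1) by blast
  then obtain Y where Y: "\<And>n. matched (X n) (Y n)" by (auto simp: choice_iff)
  \<comment> \<open>Differences of corresponding sums have equal norms, so \<open>Y\<close> inherits
    the Cauchy property from \<open>X\<close>, and completeness supplies the partner of
    \<open>b\<close>.\<close>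
  have "dist (Y m) (Y n) = dist (X m) (X n)" for m n
    unfolding dist_norm by (rule matched_norm_eq[OF matched_diff[OF Y Y], symmetric])
  then have "Cauchy Y"
    using LIMSEQ_imp_Cauchy[OF X(2)] unfolding Cauchy_def by simp
  then obtain c where "Y \<longlonglongrightarrow> c" by (auto simp: Cauchy_convergent_iff convergent_def)
  then show ?thesis using X Y unfolding extended_def by blast
qed

end

section \<open>Existence and uniqueness of the isomorphism\<close>

context two_enveloping
begin

text \<open>Under the exchange, totality becomes surjectivity and uniqueness of partners becomes
  injectivity.\<close>

interpretation swap: two_enveloping D \<alpha> \<gamma> \<beta> \<kappa> \<iota>
  by unfold_locales

lemma extended_total_right: "\<exists>b. extended b c"
  using swap.extended_total extended_swap by blast

lemma extended_unique_right: "extended b c \<Longrightarrow> extended b' c \<Longrightarrow> b = b'"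
  using swap.extended_unique extended_swap by blast

lemma ex1_equivariant_iso:
  "\<exists>!\<phi>. star_iso_on UNIV UNIV \<phi> \<and> (\<forall>t. \<phi> \<circ> \<beta> t = \<gamma> t \<circ> \<phi>) \<and> (\<forall>x. \<phi> (\<iota> x) = \<kappa> x)"
proof -
  obtain \<phi> where \<phi>: "\<And>b. extended b (\<phi> b)" using extended_total by metis
  have eq: "\<phi> b = c" if "extended b c" for b c using that \<phi> extended_unique by blast
  have incl: "\<phi> (\<iota> x) = \<kappa> x" for x
    using matched.translate[of 0 x] by (intro eq extended_matched) (simp add: B.act C.act)
  have act: "\<phi> (\<beta> t b) = \<gamma> t (\<phi> b)" for t b
    by (intro eq extended_act \<phi>)
  have hom: "star_hom_on UNIV \<phi>"
    unfolding star_hom_on_def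
    by (auto intro!: eq extended_add extended_mult extended_scaleC extended_star \<phi>)
  have "bij \<phi>"
  proof (rule bijI)
    show "inj \<phi>" by (metis \<phi> extended_unique_right injI)
    show "surj \<phi>" by (metis eq extended_total_right surjI)
  qed
  then have iso: "star_iso_on UNIV UNIV \<phi>"
    using hom by (simp add: star_iso_on_def)
  have unique: "\<psi> = \<phi>" if \<psi>: "star_hom_on UNIV \<psi>" "\<And>t b. \<psi> (\<beta> t b) = \<gamma> t (\<psi> b)"
    "\<And>x. \<psi> (\<iota> x) = \<kappa> x" for \<psi>
  proof
    fix b
    have "(\<psi> b - \<phi> b) * \<gamma> t (\<kappa> x) = 0" for t x
    proof -
      have "closed_ideal (range \<iota>)" using B.env by (simp add: enveloping_action_def)
      \<comment> \<open>The ideal absorbs the pulled-back factor, so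
        \<open>b * \<beta> t (\<iota> x)\<close> lies in a translate, where equivariance and the
        values on the ideal fix both maps.\<close>
      then obtain w where "\<beta> (- t) b * \<iota> x = \<iota> w" by (auto simp: closed_ideal_def image_iff)
      then have w: "b * \<beta> t (\<iota> x) = \<beta> t (\<iota> w)"
        by (metis B.act(5) B.act_hom(2))
      have "\<psi> b * \<gamma> t (\<kappa> x) = \<psi> (b * \<beta> t (\<iota> x))"
        by (simp add: star_hom_on_UNIV[OF \<psi>(1)] \<psi>)
      also have "\<dots> = \<phi> (b * \<beta> t (\<iota> x))"
        by (simp add: w \<psi> act incl)
      also have "\<dots> = \<phi> b * \<gamma> t (\<kappa> x)"
        by (simp add: star_hom_on_UNIV[OF hom] act incl)
      finally show ?thesis by (simp add: left_diff_distrib)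
    qed
    then have "\<psi> b - \<phi> b = 0" by (rule C.eq_0_if_annihilates)
    then show "\<psi> b = \<phi> b" by simp
  qed
  show ?thesis
  proof (rule ex1I[of _ \<phi>])
    show "star_iso_on UNIV UNIV \<phi> \<and> (\<forall>t. \<phi> \<circ> \<beta> t = \<gamma> t \<circ> \<phi>) \<and> (\<forall>x. \<phi> (\<iota> x) = \<kappa> x)"
      using iso act incl by (auto simp: fun_eq_iff)
    show "\<psi> = \<phi>" if "star_iso_on UNIV UNIV \<psi> \<and> (\<forall>t. \<psi> \<circ> \<beta> t = \<gamma> t \<circ> \<psi>) \<and>
      (\<forall>x. \<psi> (\<iota> x) = \<kappa> x)" for \<psi>
      using that by (intro unique) (auto simp: star_iso_on_def fun_eq_iff)
  qed
qed

end

theorem theorem3p8: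
  fixes D :: "'g::{topological_group_add, t2_space} \<Rightarrow> 'a::cstar_algebra set"
    and \<alpha> :: "'g \<Rightarrow> 'a \<Rightarrow> 'a"
    and \<beta> :: "'g \<Rightarrow> 'b::cstar_algebra \<Rightarrow> 'b"
    and \<gamma> :: "'g \<Rightarrow> 'c::cstar_algebra \<Rightarrow> 'c"
    and \<iota> :: "'a \<Rightarrow> 'b"
    and \<kappa> :: "'a \<Rightarrow> 'c"
  assumes "locally_compact_space (euclidean :: 'g topology)"
    and "partial_action D \<alpha>"
    and "enveloping_action D \<alpha> \<beta> \<iota>"
    and "enveloping_action D \<alpha> \<gamma> \<kappa>"
  shows "\<exists>!\<phi> :: 'b \<Rightarrow> 'c.
    star_iso_on UNIV UNIV \<phi> \<and> (\<forall>t. \<phi> \<circ> \<beta> t = \<gamma> t \<circ> \<phi>) \<and> (\<forall>x. \<phi> (\<iota> x) = \<kappa> x)"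
proof -
  interpret two_enveloping D \<alpha> \<beta> \<gamma> \<iota> \<kappa>
    using assms by unfold_locales
  show ?thesis by (rule ex1_equivariant_iso)
qed

end
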